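(* Let $\Omega\subset\mathbb{R}^N$ ($N\geq 1$) be open, let $M$ be a $\Phi$-function on $\Omega$ which is locally integrable, i.e. $\int_K M(x,c)\,dx<\infty$ for every constant $c>0$ and every compact set $K\subset\Omega$, and let $u\in\mathcal{B}_c(\Omega)$. For any $\varepsilon>0$ small enough, $u_\varepsilon\in\mathcal{C}^\infty_0(\Omega)$. Furthermore, $$\|u_\varepsilon-u\|_{L_M(\Omega)}\to0\quad\text{as }\varepsilon\to0^+.$$
   Context: A function $M:\Omega\times[0,\infty)\to[0,\infty]$ is a $\phi$-function if for all $x\in\Omega$ the function $M(x,\cdot)$ is nondecreasing and convex with $M(x,0)=0$, $M(x,s)>0$ for $s>0$, $M(x,s)\to\infty$ as $s\to\infty$, and $M(\cdot,s)$ is measurable for every $s\geq0$. It is a $\Phi$-function if moreover $\lim_{s\to0^+}M(x,s)/s=0$ and $\lim_{s\to+\infty}M(x,s)/s=+\infty$ for all $x\in\Omega$. $L_M(\Omega)$ is the space of measurable $u:\Omega\to\mathbb{R}$ (modulo a.e. equality) with $\int_\Omega M(x,|u(x)|/\lambda)\,dx<\infty$ for some $\lambda>0$, with the Luxemburg norm $\|u\|_{L_M(\Omega)}=\inf\{\lambda>0:\int_\Omega M(x,|u(x)|/\lambda)\,dx\leq1\}$. $\mathcal{B}_c(\Omega)$ is the set of bounded (measurable, real-valued) functions compactly supported in $\Omega$ (extended by $0$ to $\mathbb{R}^N$); $\mathcal{C}^\infty_0(\Omega)$ is the set of infinitely differentiable functions compactly supported in $\Omega$. Let $J(x)=ke^{-1/(1-\|x\|^2)}$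 if $\|x\|<1$ and $J(x)=0$ if $\|x\|\geq1$, with $k>0$ such that $\int_{\mathbb{R}^N}J(x)\,dx=1$. For $\varepsilon>0$, $J_\varepsilon(x)=\varepsilon^{-N}J(x\varepsilon^{-1})$ and $u_\varepsilon(x)=(J_\varepsilon*u)(x)=\int_{\mathbb{R}^N}J_\varepsilon(x-y)u(y)\,dy$. *)

theory Defs
  imports "HOL-Analysis.Analysis"
begin

text \<open>
  The space \<open>R^N\<close> with \<open>N \<ge> 1\<close> is an arbitrary type of class \<^class>\<open>euclidean_space\<close>, with
  \<open>N = DIM('a)\<close>. Measurability and integrals are with respect to Lebesgue measure. Only the values
  \<open>M x s\<close> with \<open>x \<in> \<Omega>\<close> and \<open>s \<ge> 0\<close> of a function \<open>M\<close> matter.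
\<close>

text \<open>
  Convexity is spelled out because \<^const>\<open>convex_on\<close> is restricted to real-valued functions;
  here \<open>0 * \<infinity> = 0\<close>.
\<close>

definition phi_function :: "'a::euclidean_space set \<Rightarrow> ('a \<Rightarrow> real \<Rightarrow> ennreal) \<Rightarrow> bool" where
  "phi_function \<Omega> M \<longleftrightarrow>
     (\<forall>x\<in>\<Omega>.
        mono_on {0..} (M x) \<and>
        (\<forall>s\<ge>0. \<forall>t\<ge>0. \<forall>a\<ge>0. \<forall>b\<ge>0. a + b = 1 \<longrightarrow>
           M x (a * s + b * t) \<le> ennreal a * M x s + ennreal b * M x t) \<and>
        M x 0 = 0 \<and>
        (\<forall>s>0. M x s > 0) \<and>
        (M x \<longlongrightarrow> \<infinity>) at_top) \<and>
     (\<forall>s\<ge>0. (\<lambda>x. M x s) \<in> borel_measurable (lebesgue_on \<Omega>))"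

definition Phi_function :: "'a::euclidean_space set \<Rightarrow> ('a \<Rightarrow> real \<Rightarrow> ennreal) \<Rightarrow> bool" where
  "Phi_function \<Omega> M \<longleftrightarrow>
     phi_function \<Omega> M \<and>
     (\<forall>x\<in>\<Omega>.
        ((\<lambda>s. M x s / ennreal s) \<longlongrightarrow> 0) (at_right 0) \<and>
        ((\<lambda>s. M x s / ennreal s) \<longlongrightarrow> \<infinity>) at_top)"

definition locally_integrable :: "'a::euclidean_space set \<Rightarrow> ('a \<Rightarrow> real \<Rightarrow> ennreal) \<Rightarrow> bool" where
  "locally_integrable \<Omega> M \<longleftrightarrow>
     (\<forall>c>0. \<forall>K. compact K \<and> K \<subseteq> \<Omega> \<longrightarrow> (\<integral>\<^sup>+x. M x c \<partial>lebesgue_on K) < \<infinity>)"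

definition modular ::
  "'a::euclidean_space set \<Rightarrow> ('a \<Rightarrow> real \<Rightarrow> ennreal) \<Rightarrow> ('a \<Rightarrow> real) \<Rightarrow> ennreal" where
  "modular \<Omega> M u = (\<integral>\<^sup>+x. M x \<bar>u x\<bar> \<partial>lebesgue_on \<Omega>)"

text \<open>
  Elements of \<open>L_M(\<Omega>)\<close> are represented by functions; neither membership nor the norm depends on
  the representative.
\<close>

definition musielak_orlicz_space ::
  "'a::euclidean_space set \<Rightarrow> ('a \<Rightarrow> real \<Rightarrow> ennreal) \<Rightarrow> ('a \<Rightarrow> real) set" where
  "musielak_orlicz_space \<Omega> M =
     {u \<in> borel_measurable (lebesgue_on \<Omega>). \<exists>l>0. modular \<Omega> M (\<lambda>x. u x / l) < \<infinity>}"

text \<open>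
  The infimum of a set of reals is meaningful only for nonempty sets, so the following is used
  only for members of the space above.
\<close>

definition luxemburg_norm ::
  "'a::euclidean_space set \<Rightarrow> ('a \<Rightarrow> real \<Rightarrow> ennreal) \<Rightarrow> ('a \<Rightarrow> real) \<Rightarrow> real" where
  "luxemburg_norm \<Omega> M u = Inf {l. l > 0 \<and> modular \<Omega> M (\<lambda>x. u x / l) \<le> 1}"

text \<open>
  Functions compactly supported in \<open>\<Omega>\<close> are represented by their extension by \<open>0\<close> to the whole space.
\<close>

definition compactly_supported_in :: "'a::euclidean_space set \<Rightarrow> ('a \<Rightarrow> real) \<Rightarrow> bool" where
  "compactly_supported_in \<Omega> u \<longleftrightarrow>
     compact (closure {x. u x \<noteq> 0}) \<and> closure {x. u x \<noteq> 0} \<subseteq> \<Omega>"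

definition bounded_compact_support :: "'a::euclidean_space set \<Rightarrow> ('a \<Rightarrow> real) set" where
  "bounded_compact_support \<Omega> =
     {u \<in> borel_measurable lebesgue. bounded (range u) \<and> compactly_supported_in \<Omega> u}"

primrec Ck :: "nat \<Rightarrow> ('a::euclidean_space \<Rightarrow> real) \<Rightarrow> bool" where
  "Ck 0 f \<longleftrightarrow> continuous_on UNIV f"
| "Ck (Suc n) f \<longleftrightarrow>
     (\<forall>x. f differentiable (at x)) \<and> (\<forall>v. Ck n (\<lambda>x. frechet_derivative f (at x) v))"

definition test_functions :: "'a::euclidean_space set \<Rightarrow> ('a \<Rightarrow> real) set" where
  "test_functions \<Omega> = {f. (\<forall>n. Ck n f) \<and> compactly_supported_in \<Omega> f}"

definition bump :: "'a::euclidean_space \<Rightarrow> real" where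
  "bump x = (if norm x < 1 then exp (- 1 / (1 - (norm x)\<^sup>2)) else 0)"

definition mollifier_const :: "'a::euclidean_space itself \<Rightarrow> real" where
  "mollifier_const _ = 1 / (\<integral>x. bump (x::'a) \<partial>lebesgue)"

definition J :: "'a::euclidean_space \<Rightarrow> real" where
  "J x = mollifier_const TYPE('a) * bump x"

definition J_eps :: "real \<Rightarrow> 'a::euclidean_space \<Rightarrow> real" where
  "J_eps \<epsilon> x = J (x /\<^sub>R \<epsilon>) / \<epsilon> ^ DIM('a)"

definition mollify :: "real \<Rightarrow> ('a::euclidean_space \<Rightarrow> real) \<Rightarrow> 'a \<Rightarrow> real" where
  "mollify \<epsilon> u x = (\<integral>y. J_eps \<epsilon> (x - y) * u y \<partial>lebesgue)"

lemma bump_integrable: "integrable lebesgue (bump :: 'a::euclidean_space \<Rightarrow> real)"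
proof (rule Bochner_Integration.integrable_bound)
  show "integrable lebesgue (indicat_real (ball (0::'a) 1))"
    by (rule lmeasurable_iff_integrable[THEN iffD1, OF lmeasurable_ball])
  have "bump \<in> borel_measurable (borel :: 'a measure)"
    unfolding bump_def by measurable
  then show "(bump :: 'a \<Rightarrow> real) \<in> borel_measurable lebesgue"
    by (simp add: borel_measurable_if_I measurable_completion)
  show "AE x in lebesgue. norm (bump (x::'a)) \<le> norm (indicat_real (ball (0::'a) 1) x)"
    by (intro always_eventually allI)
       (auto simp: bump_def indicator_def power_less_one_iff abs_square_le_1 less_imp_le)
qed

lemma bump_integral_pos: "(\<integral>x. bump (x::'a::euclidean_space) \<partial>lebesgue) > 0"
proof -
  let ?B = "ball (0::'a) (1/2)"
  have "0 < exp (-2) * measure lebesgue ?B"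
    using content_ball_pos[of "1/2" "0::'a"] by simp
  also have "\<dots> = (\<integral>x. exp (-2) * indicat_real ?B x \<partial>lebesgue)"
    by simp
  also have "\<dots> \<le> (\<integral>x. bump (x::'a) \<partial>lebesgue)"
  proof (rule integral_mono)
    show "integrable lebesgue (\<lambda>x. exp (-2) * indicat_real ?B x)"
      by (intro integrable_mult_right lmeasurable_iff_integrable[THEN iffD1, OF lmeasurable_ball])
    show "exp (-2) * indicat_real ?B x \<le> bump x" for x :: 'a
    proof (cases "x \<in> ?B")
      case True
      then have "(norm x)\<^sup>2 \<le> (1/2)\<^sup>2" by (intro power_mono) auto
      then have "1 / (1 - (norm x)\<^sup>2) \<le> 2" by (simp add: field_simps power2_eq_square)
      with True show ?thesis by (simp add: bump_def)
    qed (simp add: bump_def)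
  qed (rule bump_integrable)
  finally show ?thesis .
qed

lemma mollifier_const_pos: "mollifier_const TYPE('a::euclidean_space) > 0"
  by (simp add: mollifier_const_def bump_integral_pos)

lemma J_integral: "(\<integral>x. J (x::'a::euclidean_space) \<partial>lebesgue) = 1"
  using bump_integral_pos[where 'a='a] by (simp add: J_def mollifier_const_def)

end

theory Submission
  imports Defs
begin

text \<open>
  Write \<open>w = u\<^sub>\<epsilon> - u\<close> and let \<open>B\<close> bound \<open>\<bar>u\<bar>\<close>, so that \<open>\<bar>w\<bar> \<le> 2B\<close> and, for small \<open>\<epsilon>\<close>, \<open>w\<close> vanishes off a
  fixed compact set \<open>K \<subseteq> \<Omega>\<close>. Convexity and \<open>M(x,0) = 0\<close> give
  \<open>M(x, \<bar>w\<bar>/l) \<le> (\<bar>w\<bar>/(2B)) M(x, 2B/l)\<close>, where \<open>M(\<sqdot>, 2B/l)\<close> is integrable on \<open>K\<close>. So it suffices that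
  \<open>\<integral> \<bar>w\<bar> F \<rightarrow> 0\<close> for every integrable weight \<open>F\<close>; truncating \<open>F\<close> at a large height and using
  \<open>\<bar>w\<bar> \<le> 2B\<close> on the excess, this reduces to \<open>u\<^sub>\<epsilon> \<rightarrow> u\<close> in \<open>L\<^sup>1\<close>. The latter follows by approximating \<open>u\<close>
  in \<open>L\<^sup>1\<close> by a continuous compactly supported function, on which mollification converges
  uniformly, since mollification is an \<open>L\<^sup>1\<close> contraction by Fubini.

  Smoothness of the kernel: the functions generated from constants and linear forms by sums,
  products and composition with \<open>t \<mapsto> t\<^sup>-\<^sup>k exp(-1/t)\<close> (extended by \<open>0\<close> to \<open>t \<le> 0\<close>) are closed under
  directional derivatives, and the kernel is one of them.
\<close>

section \<open>Smoothness of the kernel\<close>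

definition flat :: "nat \<Rightarrow> real \<Rightarrow> real" where
  "flat k t = (if t > 0 then inverse t ^ k * exp (- inverse t) else 0)"

text \<open>On the right, the substitution s = 1/t turns the claim into s^k / exp s tending to 0 at
  infinity; on the left the function is identically 0.\<close>

lemma flat_tendsto_0: "(flat k \<longlongrightarrow> 0) (at 0)"
proof -
  have "((\<lambda>t. inverse t ^ k / exp (inverse t)) \<longlongrightarrow> (0::real)) (at_right 0)"
    by (rule filterlim_compose[OF tendsto_power_div_exp_0 filterlim_inverse_at_top_right])
  then have "(flat k \<longlongrightarrow> 0) (at_right 0)"
    by (rule tendsto_cong[THEN iffD1, rotated])
       (auto simp: flat_def eventually_at_filter exp_minus divide_inverse)
  moreover have "(flat k \<longlongrightarrow> 0) (at_left 0)"
    by (rule tendsto_eventually) (auto simp: flat_def eventually_at_filter)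
  ultimately show ?thesis
    by (simp add: filterlim_at_split)
qed

text \<open>For t > 0 this is the product rule: the exponential contributes two further powers of
  1/t, the power one. Keeping the exponent k as a parameter makes the family closed under
  differentiation.\<close>

lemma flat_has_real_derivative:
  "(flat k has_real_derivative flat (k + 2) t - k * flat (k + 1) t) (at t)"
proof (cases t "0::real" rule: linorder_cases)
  case less
  have "((\<lambda>_. 0) has_real_derivative 0) (at t)" by simp
  then have "(flat k has_real_derivative 0) (at t)"
    by (rule has_field_derivative_transform_within_open[where S = "{..<0}"])
       (use less in \<open>auto simp: flat_def\<close>)
  with less show ?thesis by (simp add: flat_def)
next
  case equal
  have "(flat k \<longlongrightarrow> 0) (at 0)" for k by (rule flat_tendsto_0)
  \<comment> \<open>At 0 the difference quotient of \<open>flat k\<close> is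
    \<open>flat (Suc k)\<close>, because \<open>flat k 0 = 0\<close> and dividing by h adds one
    power of 1/h.\<close>
  then have "((\<lambda>h. (flat k (0 + h) - flat k 0) / h) \<longlongrightarrow> 0) (at 0)"
    by (rule tendsto_cong[THEN iffD1, rotated, where f1="flat (Suc k)"])
       (auto simp: flat_def divide_inverse)
  then show ?thesis
    using equal by (simp add: DERIV_def flat_def)
next
  case greater
  have "((\<lambda>t. inverse t ^ k * exp (- inverse t)) has_real_derivative
      flat (k + 2) t - k * flat (k + 1) t) (at t)"
    \<comment> \<open>The later case split on k is for the truncated exponent k - 1 produced by the
      power rule.\<close>
    by (rule derivative_eq_intros refl | use greater in \<open>simp; fail\<close>)+
       (use greater in \<open>cases k; simp add: flat_def field_simps power2_eq_square\<close>)
  then show ?thesis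
    by (rule has_field_derivative_transform_within_open[where S = "{0<..}"])
       (use greater in \<open>auto simp: flat_def\<close>)
qed

inductive elementary_smooth :: "('a::euclidean_space \<Rightarrow> real) \<Rightarrow> bool" where
  const: "elementary_smooth (\<lambda>x. c)"
| inner: "elementary_smooth (\<lambda>x. x \<bullet> v)"
| add: "elementary_smooth f \<Longrightarrow> elementary_smooth g \<Longrightarrow> elementary_smooth (\<lambda>x. f x + g x)"
| mult: "elementary_smooth f \<Longrightarrow> elementary_smooth g \<Longrightarrow> elementary_smooth (\<lambda>x. f x * g x)"
| flat: "elementary_smooth f \<Longrightarrow> elementary_smooth (\<lambda>x. flat k (f x))"

text \<open>Each generator has an explicit derivative. Recording that every directional derivative
  is again in the class is what allows iteration to all orders in
  \<open>elementary_smooth_Ck\<close>.\<close>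

lemma elementary_smooth_has_derivative:
  assumes "elementary_smooth f"
  shows "\<exists>f'. (\<forall>x. (f has_derivative f' x) (at x)) \<and> (\<forall>v. elementary_smooth (\<lambda>x. f' x v))"
  using assms
proof induction
  case (const c)
  show ?case
    by (rule exI[of _ "\<lambda>x v. 0"]) (auto intro: elementary_smooth.const)
next
  case (inner w)
  show ?case
    by (rule exI[of _ "\<lambda>x v. v \<bullet> w"])
       (auto intro: elementary_smooth.const bounded_linear_imp_has_derivative bounded_linear_inner_left)
next
  case (add f g)
  then obtain f' g' where
    "\<And>x. (f has_derivative f' x) (at x)" "\<And>v. elementary_smooth (\<lambda>x. f' x v)"
    "\<And>x. (g has_derivative g' x) (at x)" "\<And>v. elementary_smooth (\<lambda>x. g' x v)"
    by blast
  then show ?case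
    by (intro exI[of _ "\<lambda>x v. f' x v + g' x v"])
       (auto intro: elementary_smooth.add has_derivative_add)
next
  case (mult f g)
  then obtain f' g' where
    "\<And>x. (f has_derivative f' x) (at x)" "\<And>v. elementary_smooth (\<lambda>x. f' x v)"
    "\<And>x. (g has_derivative g' x) (at x)" "\<And>v. elementary_smooth (\<lambda>x. g' x v)"
    by blast
  with mult.hyps show ?case
    by (intro exI[of _ "\<lambda>x v. f x * g' x v + f' x v * g x"])
       (auto intro!: elementary_smooth.add elementary_smooth.mult has_derivative_mult)
next
  case (flat f k)
  then obtain f' where f':
    "\<And>x. (f has_derivative f' x) (at x)" "\<And>v. elementary_smooth (\<lambda>x. f' x v)"
    by blast
  \<comment> \<open>The chain rule, with the difference written as a sum with a negative coefficient
    because the class is generated by sums and products.\<close>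
  have "((\<lambda>x. flat k (f x)) has_derivative
      (\<lambda>v. (flat (k + 2) (f x) + - real k * flat (k + 1) (f x)) * f' x v)) (at x)" for x
    using DERIV_compose_FDERIV[OF flat_has_real_derivative f'(1)[of x]] by (simp add: mult.commute)
  moreover have "elementary_smooth (\<lambda>x. (flat (k + 2) (f x) + - real k * flat (k + 1) (f x)) * f' x v)" for v
    by (intro elementary_smooth.add elementary_smooth.mult elementary_smooth.const
        elementary_smooth.flat flat.hyps f'(2))
  ultimately show ?case
    by (intro exI[of _ "\<lambda>x v. (flat (k + 2) (f x) + - real k * flat (k + 1) (f x)) * f' x v"]) blast
qed

lemma elementary_smooth_Ck:
  assumes "elementary_smooth f"
  shows "Ck n f"
  using assms
proof (induction n arbitrary: f)
  case 0
  then obtain f' where "\<And>x. (f has_derivative f' x) (at x)"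
    using elementary_smooth_has_derivative by blast
  then show ?case
    by (metis Ck.simps(1) continuous_at_imp_continuous_on has_derivative_continuous)
next
  case (Suc n)
  obtain f' where f': "\<And>x. (f has_derivative f' x) (at x)" "\<And>v. elementary_smooth (\<lambda>x. f' x v)"
    using elementary_smooth_has_derivative[OF Suc.prems] by blast
  have "frechet_derivative f (at x) = f' x" for x
    using frechet_derivative_at[OF f'(1)] by simp
  with f' Suc.IH show ?case by (auto simp: differentiable_def)
qed

lemma elementary_smooth_sum:
  assumes "\<And>i. i \<in> I \<Longrightarrow> elementary_smooth (f i)"
  shows "elementary_smooth (\<lambda>x. \<Sum>i\<in>I. f i x)"
  using assms by (induction I rule: infinite_finite_induct) (auto intro: elementary_smooth.intros)

text \<open>Passing to the squared norm removes \<open>norm\<close>, which is not differentiable at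
  0: the bump becomes \<open>flat\<close> composed with a quadratic polynomial.\<close>

lemma bump_eq_flat: "bump x = flat 0 (1 - x \<bullet> x)"
proof -
  have "norm x < 1 \<longleftrightarrow> 1 - x \<bullet> x > 0"
    using abs_square_less_1[of "norm x"] by (simp add: dot_square_norm)
  then show ?thesis
    by (simp add: bump_def flat_def dot_square_norm inverse_eq_divide)
qed

lemma Ck_J_eps: "Ck n (J_eps \<epsilon> :: 'a::euclidean_space \<Rightarrow> real)"
proof (rule elementary_smooth_Ck)
  \<comment> \<open>The inner product is expanded in coordinates so that only linear forms occur.
    The identity also covers \<epsilon> = 0, where division by zero makes both sides 0.\<close>
  have eq: "J_eps \<epsilon> = (\<lambda>x::'a. mollifier_const TYPE('a) / \<epsilon> ^ DIM('a) *
      flat 0 (1 + - (1 / \<epsilon>\<^sup>2) * (\<Sum>b\<in>Basis. (x \<bullet> b) * (x \<bullet> b))))"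
    unfolding fun_eq_iff J_eps_def J_def bump_eq_flat
    by (simp add: power2_eq_square divide_inverse ac_simps flip: euclidean_inner)
  show "elementary_smooth (J_eps \<epsilon> :: 'a \<Rightarrow> real)"
    unfolding eq by (intro elementary_smooth.intros elementary_smooth_sum)
qed

section \<open>Differentiation of convolutions\<close>

lemma continuous_on_UNIV_measurable_lebesgue:
  fixes f :: "'a::euclidean_space \<Rightarrow> real"
  assumes "continuous_on UNIV f"
  shows "f \<in> borel_measurable lebesgue"
  using assms by (simp add: measurable_completion borel_measurable_continuous_onI)

lemma integrable_bounded_continuous_mult:
  fixes g w :: "'a::euclidean_space \<Rightarrow> real"
  assumes "continuous_on UNIV g" "\<And>x. \<bar>g x\<bar> \<le> B" "integrable lebesgue w"
  shows "integrable lebesgue (\<lambda>y. g (x - y) * w y)"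
proof (rule Bochner_Integration.integrable_bound)
  show "integrable lebesgue (\<lambda>y. B * w y)" using assms by simp
  have "continuous_on UNIV (\<lambda>y. g (x - y))"
    by (rule continuous_on_compose2[OF assms(1)]) (auto intro: continuous_intros)
  from continuous_on_UNIV_measurable_lebesgue[OF this] assms(3)
  show "(\<lambda>y. g (x - y) * w y) \<in> borel_measurable lebesgue" by auto
  have "\<bar>g z\<bar> \<le> \<bar>B\<bar>" for z using assms(2)[of z] by linarith
  then show "AE y in lebesgue. norm (g (x - y) * w y) \<le> norm (B * w y)"
    by (auto simp: abs_mult intro!: mult_right_mono)
qed

lemma bounded_continuous_of_bounded_support:
  fixes g :: "'a::euclidean_space \<Rightarrow> real"
  assumes "continuous_on UNIV g" "bounded {x. g x \<noteq> 0}"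
  obtains B where "\<And>x. \<bar>g x\<bar> \<le> B"
proof -
  have "compact (g ` closure {x. g x \<noteq> 0})"
    using assms by (intro compact_continuous_image) (auto intro: continuous_on_subset)
  then obtain B where B: "\<And>x. x \<in> closure {x. g x \<noteq> 0} \<Longrightarrow> \<bar>g x\<bar> \<le> B"
    using compact_imp_bounded bounded_iff by (metis (no_types) imageI real_norm_def)
  have "\<bar>g x\<bar> \<le> max B 0" for x
    using B[of x] closure_subset[of "{x. g x \<noteq> 0}"] by (cases "g x = 0") auto
  then show ?thesis using that by blast
qed

text \<open>Off the closed support g vanishes on an open set, so its derivative is 0 there. This
  lets an induction on the order pass from g to its directional derivatives.\<close>

lemma bounded_support_frechet_derivative:
  fixes g :: "'a::euclidean_space \<Rightarrow> real"
  assumes "bounded {x. g x \<noteq> 0}"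
  shows "bounded {x. frechet_derivative g (at x) v \<noteq> 0}"
proof (rule bounded_subset[OF bounded_closure[OF assms]], rule subsetI, rule ccontr)
  fix x assume x: "x \<in> {x. frechet_derivative g (at x) v \<noteq> 0}" "x \<notin> closure {x. g x \<noteq> 0}"
  have "(g has_derivative (\<lambda>_. 0)) (at x)"
    by (rule has_derivative_transform_within_open[of "\<lambda>_. 0" _ _ _ "- closure {x. g x \<noteq> 0}"])
       (use x closure_subset[of "{x. g x \<noteq> 0}"] in auto)
  from fun_cong[OF frechet_derivative_at[OF this], of v] x show False by auto
qed

text \<open>All derivatives fall on g, so w need only be integrable. The interchange of limit and
  integral is dominated convergence, the majorant coming from a Lipschitz bound for g.\<close>

lemma has_derivative_convolution:
  fixes g w :: "'a::euclidean_space \<Rightarrow> real"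
  assumes g: "\<And>n. Ck n g" and supp: "bounded {x. g x \<noteq> 0}" and w: "integrable lebesgue w"
  shows "((\<lambda>x. \<integral>y. g (x - y) * w y \<partial>lebesgue) has_derivative
    (\<lambda>v. \<integral>y. frechet_derivative g (at (x - y)) v * w y \<partial>lebesgue)) (at x)"
proof -
  let ?D = "\<lambda>x. frechet_derivative g (at x)"
  have der: "(g has_derivative ?D x) (at x)" for x
    using g[of 1] frechet_derivative_works by (auto simp del: Ck.simps simp: Ck.simps(2) One_nat_def)
  have cont: "continuous_on UNIV (\<lambda>x. ?D x v)" for v
    using g[of 1] by simp
  have contg: "continuous_on UNIV g" using g[of 0] by simp
  have lin: "linear (?D x)" for x
    using der has_derivative_linear by blast
  obtain G where G: "\<And>x. \<bar>g x\<bar> \<le> G"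
    using bounded_continuous_of_bounded_support[OF contg supp] by blast
  have "\<exists>B. \<forall>x. \<bar>?D x v\<bar> \<le> B" for v
    by (rule bounded_continuous_of_bounded_support[OF cont bounded_support_frechet_derivative[OF supp]])
      blast
  then obtain B where B: "\<And>v x. \<bar>?D x v\<bar> \<le> B v"
    by metis
  \<comment> \<open>Expanding a direction in the basis and adding the bounds for the basis
    directions bounds the derivative uniformly in the point; by the mean value inequality L is then
    a Lipschitz constant of g.\<close>
  define L where "L = (\<Sum>b\<in>Basis. B b)"
  have L: "\<bar>?D x v\<bar> \<le> L * norm v" for x v
  proof -
    have "?D x v = (\<Sum>b\<in>Basis. (v \<bullet> b) * ?D x b)"
      using linear_sum[OF lin, of x "\<lambda>b. (v \<bullet> b) *\<^sub>R b" Basis]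
      by (simp add: euclidean_representation linear_cmul[OF lin])
    also have "\<bar>\<dots>\<bar> \<le> (\<Sum>b\<in>Basis. \<bar>(v \<bullet> b) * ?D x b\<bar>)" by (rule sum_abs)
    also have "\<dots> \<le> (\<Sum>b\<in>Basis. norm v * B b)"
      by (intro sum_mono) (auto simp: abs_mult Basis_le_norm B intro!: mult_mono)
    finally show ?thesis by (simp add: L_def sum_distrib_left mult.commute)
  qed
  have Lip: "\<bar>g x - g y\<bar> \<le> L * norm (x - y)" for x y
    using differentiable_bound[of UNIV g ?D L x y] der L
    by (simp add: onorm_le has_derivative_at_withinI)
  have int: "integrable lebesgue (\<lambda>y. ?D (x - y) v * w y)" for x v
    using integrable_bounded_continuous_mult[OF cont B(1) w] .
  have intg: "integrable lebesgue (\<lambda>y. g (x - y) * w y)" for x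
    using integrable_bounded_continuous_mult[OF contg G w] .
  have "linear (\<lambda>v. \<integral>y. ?D (x - y) v * w y \<partial>lebesgue)"
  proof (rule linearI)
    fix v v'
    show "(\<integral>y. ?D (x - y) (v + v') * w y \<partial>lebesgue) =
        (\<integral>y. ?D (x - y) v * w y \<partial>lebesgue) + (\<integral>y. ?D (x - y) v' * w y \<partial>lebesgue)"
      by (subst Bochner_Integration.integral_add[symmetric])
         (auto simp: int linear_add[OF lin] distrib_right)
  next
    fix r v
    show "(\<integral>y. ?D (x - y) (r *\<^sub>R v) * w y \<partial>lebesgue) =
        r *\<^sub>R (\<integral>y. ?D (x - y) v * w y \<partial>lebesgue)"
      by (simp add: linear_cmul[OF lin] mult.assoc)
  qed
  then have bl: "bounded_linear (\<lambda>v. \<integral>y. ?D (x - y) v * w y \<partial>lebesgue)"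
    by (rule linear_conv_bounded_linear[THEN iffD1])
  \<comment> \<open>The first-order remainder of g at x - y, relative to the length of z - x. It is
    bounded by 2L (Lipschitz part plus linear part) and tends to 0 for each fixed y as z tends to
    x.\<close>
  define q where "q z y = (g (z - y) - g (x - y) - ?D (x - y) (z - x)) / norm (z - x)" for z y
  have q_bound: "\<bar>q z y\<bar> \<le> 2 * L" if "z \<noteq> x" for z y
  proof -
    have "\<bar>g (z - y) - g (x - y) - ?D (x - y) (z - x)\<bar> \<le> 2 * L * norm (z - x)"
      using Lip[of "z - y" "x - y"] L[of "x - y" "z - x"] by simp
    then show ?thesis using that by (simp add: q_def field_simps)
  qed
  have q_int: "(\<lambda>y. q z y * w y) \<in> borel_measurable lebesgue" for z
    using intg[of z, THEN borel_measurable_integrable] intg[of x, THEN borel_measurable_integrable]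
      int[of x "z - x", THEN borel_measurable_integrable]
    unfolding q_def left_diff_distrib diff_divide_distrib times_divide_eq_left by measurable
  have "((\<lambda>z. \<integral>y. q z y * w y \<partial>lebesgue) \<longlongrightarrow> (\<integral>y. 0 \<partial>(lebesgue::'a measure))) (at x)"
    \<comment> \<open>The limit is tested along sequences avoiding x, to which dominated convergence
      with majorant 2L|w| applies.\<close>
    unfolding tendsto_at_iff_sequentially
  proof (intro allI impI)
    fix X :: "nat \<Rightarrow> 'a" assume X: "\<forall>i. X i \<in> UNIV - {x}" "X \<longlonglongrightarrow> x"
    show "((\<lambda>z. \<integral>y. q z y * w y \<partial>lebesgue) \<circ> X) \<longlonglongrightarrow> (\<integral>y. 0 \<partial>(lebesgue::'a measure))"
      unfolding o_def
    proof (rule integral_dominated_convergence)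
      show "integrable lebesgue (\<lambda>y. 2 * L * \<bar>w y\<bar>)" using w by auto
      show "AE y in lebesgue. norm (q (X i) y * w y) \<le> 2 * L * \<bar>w y\<bar>" for i
        using q_bound X(1) by (auto simp: abs_mult intro!: mult_right_mono)
      show "AE y in lebesgue. (\<lambda>i. q (X i) y * w y) \<longlonglongrightarrow> 0"
      proof (intro always_eventually allI tendsto_mult_left_zero)
        fix y
        have "(g has_derivative ?D (x - y)) (at (x - y))" by (rule der)
        moreover have "((\<lambda>z. z - y) has_derivative (\<lambda>v. v)) (at x)"
          by (auto intro!: derivative_eq_intros)
        ultimately have "((\<lambda>z. g (z - y)) has_derivative ?D (x - y)) (at x)"
          using has_derivative_compose[of "\<lambda>z. z - y" "\<lambda>v. v" x UNIV g "?D (x - y)"] by simp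
        then have "((\<lambda>z. norm (q z y)) \<longlongrightarrow> 0) (at x)"
          by (simp add: has_derivative_iff_norm q_def)
        then have "((\<lambda>z. q z y) \<longlongrightarrow> 0) (at x)"
          by (rule tendsto_norm_zero_cancel)
        with X show "(\<lambda>i. q (X i) y) \<longlonglongrightarrow> 0"
          by (auto simp: tendsto_at_iff_sequentially o_def)
      qed
    qed (auto intro: q_int)
  qed
  then have "((\<lambda>z. norm (\<integral>y. q z y * w y \<partial>lebesgue)) \<longlongrightarrow> 0) (at x)"
    by (simp add: tendsto_rabs_zero_iff)
  \<comment> \<open>By linearity the integral of q w is the relative remainder of the convolution
    itself, so its vanishing is the claimed differentiability.\<close>
  moreover have "(\<integral>y. q z y * w y \<partial>lebesgue) = ((\<integral>y. g (z - y) * w y \<partial>lebesgue) -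
      (\<integral>y. g (x - y) * w y \<partial>lebesgue) - (\<integral>y. ?D (x - y) (z - x) * w y \<partial>lebesgue)) / norm (z - x)" for z
    by (simp add: q_def left_diff_distrib diff_divide_distrib int intg)
  ultimately show ?thesis
    using bl by (simp add: has_derivative_iff_norm)
qed

text \<open>Induction with the kernel generalised: a directional derivative of the convolution is
  the convolution with that derivative of g, again smooth with bounded support.\<close>

lemma Ck_convolution:
  fixes g w :: "'a::euclidean_space \<Rightarrow> real"
  assumes "\<And>n. Ck n g" and "bounded {x. g x \<noteq> 0}" and w: "integrable lebesgue w"
  shows "Ck n (\<lambda>x. \<integral>y. g (x - y) * w y \<partial>lebesgue)"
  using assms(1,2)
proof (induction n arbitrary: g)
  case 0
  then show ?case
    using has_derivative_convolution[OF 0 w]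
    by (auto intro!: continuous_at_imp_continuous_on has_derivative_continuous)
next
  case (Suc n)
  note der = has_derivative_convolution[OF Suc.prems w]
  have "Ck n (\<lambda>x. \<integral>y. frechet_derivative g (at (x - y)) v * w y \<partial>lebesgue)" for v
    using Suc.prems(1)[of "Suc _"] bounded_support_frechet_derivative[OF Suc.prems(2)]
    by (intro Suc.IH) auto
  then show ?case
    using der frechet_derivative_at[OF der, symmetric] by (auto simp: differentiable_def)
qed

section \<open>Unit mass of the kernel and basic estimates for mollification\<close>

lemma J_eps_nonneg: "\<epsilon> > 0 \<Longrightarrow> J_eps \<epsilon> (x::'a::euclidean_space) \<ge> 0"
  using mollifier_const_pos[where 'a='a] by (simp add: J_eps_def J_def bump_def)

lemma J_eps_eq_0: "\<epsilon> > 0 \<Longrightarrow> norm x \<ge> \<epsilon> \<Longrightarrow> J_eps \<epsilon> x = 0"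
  by (simp add: J_eps_def J_def bump_def field_simps)

lemma J_eps_minus_commute: "J_eps \<epsilon> (x - y) = J_eps \<epsilon> (y - x)"
proof -
  have "norm ((x - y) /\<^sub>R \<epsilon>) = norm ((y - x) /\<^sub>R \<epsilon>)" by (simp add: norm_minus_commute)
  then show ?thesis by (simp only: J_eps_def J_def bump_def)
qed

lemma continuous_on_J_eps: "continuous_on UNIV (J_eps \<epsilon> :: 'a::euclidean_space \<Rightarrow> real)"
  using Ck_J_eps[of 0] by simp

lemma bounded_support_J_eps: "\<epsilon> > 0 \<Longrightarrow> bounded {x. J_eps \<epsilon> x \<noteq> 0}"
  by (rule bounded_subset[OF bounded_ball[of 0 \<epsilon>]]) (use J_eps_eq_0 in \<open>force simp: not_less\<close>)

lemma J_eps_measurable [measurable]: "J_eps \<epsilon> \<in> borel_measurable borel"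
  by (rule borel_measurable_continuous_onI[OF continuous_on_J_eps])

lemma nn_integral_lborel_affine:
  fixes t :: "'a::euclidean_space"
  assumes [measurable]: "f \<in> borel_measurable borel" and "c \<noteq> 0"
  shows "(\<integral>\<^sup>+x. f x \<partial>lborel) = ennreal (\<bar>c\<bar> ^ DIM('a)) * (\<integral>\<^sup>+x. f (t + c *\<^sub>R x) \<partial>lborel)"
  by (subst lborel_affine[OF \<open>c \<noteq> 0\<close>, of t])
     (simp add: nn_integral_density nn_integral_distr nn_integral_cmult)

lemma nn_integral_J: "(\<integral>\<^sup>+x. ennreal (J (x::'a::euclidean_space)) \<partial>lborel) = 1"
proof -
  have "integrable lebesgue (J :: 'a \<Rightarrow> real)"
    unfolding J_def using bump_integrable by auto
  moreover have "J x \<ge> 0" for x :: 'a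
    using J_eps_nonneg[of 1 x] by (simp add: J_eps_def)
  ultimately have "(\<integral>\<^sup>+x. ennreal (J (x::'a)) \<partial>lebesgue) = 1"
    by (simp add: nn_integral_eq_integral J_integral)
  then show ?thesis by (simp add: nn_integral_completion)
qed

lemma nn_integral_J_eps:
  fixes x :: "'a::euclidean_space"
  assumes "\<epsilon> > 0"
  shows "(\<integral>\<^sup>+y. ennreal (J_eps \<epsilon> (x - y)) \<partial>lborel) = 1"
proof -
  \<comment> \<open>Reflection, translation and scaling in one affine substitution; its Jacobian
    cancels the normalising power of \<epsilon> in \<open>J_eps\<close>.\<close>
  have "(\<integral>\<^sup>+y. ennreal (J_eps \<epsilon> (x - y)) \<partial>lborel) =
      ennreal (\<epsilon> ^ DIM('a)) * (\<integral>\<^sup>+y. ennreal (J_eps \<epsilon> (x - (x + (- \<epsilon>) *\<^sub>R y))) \<partial>lborel)"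
    using assms by (subst nn_integral_lborel_affine[where t=x and c="- \<epsilon>"]) auto
  also have "\<dots> = (\<integral>\<^sup>+y. ennreal (\<epsilon> ^ DIM('a)) * ennreal (J_eps \<epsilon> (\<epsilon> *\<^sub>R (y::'a))) \<partial>lborel)"
    by (simp add: nn_integral_cmult)
  also have "\<dots> = (\<integral>\<^sup>+y. ennreal (J (y::'a)) \<partial>lborel)"
    using assms by (intro nn_integral_cong) (simp add: J_eps_def ennreal_mult'[symmetric])
  finally show ?thesis by (simp add: nn_integral_J)
qed

lemma
  fixes x :: "'a::euclidean_space"
  assumes "\<epsilon> > 0"
  shows integrable_J_eps: "integrable lebesgue (\<lambda>y. J_eps \<epsilon> (x - y))"
    and integral_J_eps: "(\<integral>y. J_eps \<epsilon> (x - y) \<partial>lebesgue) = 1"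
proof -
  have "has_bochner_integral lebesgue (\<lambda>y. J_eps \<epsilon> (x - y)) 1"
    using assms
    by (intro has_bochner_integral_nn_integral)
       (auto simp: J_eps_nonneg nn_integral_completion nn_integral_J_eps intro!: measurable_completion)
  then show "integrable lebesgue (\<lambda>y. J_eps \<epsilon> (x - y))" "(\<integral>y. J_eps \<epsilon> (x - y) \<partial>lebesgue) = 1"
    by (simp_all add: has_bochner_integral_iff)
qed

lemma Ck_mollify:
  fixes w :: "'a::euclidean_space \<Rightarrow> real"
  assumes "\<epsilon> > 0" "integrable lebesgue w"
  shows "Ck n (mollify \<epsilon> w)"
  using Ck_convolution[OF Ck_J_eps bounded_support_J_eps assms(2)] assms(1)
  by (simp add: mollify_def[abs_def])

lemma continuous_on_mollify:
  fixes w :: "'a::euclidean_space \<Rightarrow> real"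
  assumes "\<epsilon> > 0" "integrable lebesgue w"
  shows "continuous_on UNIV (mollify \<epsilon> w)"
  using Ck_mollify[OF assms, of 0] by simp

lemma integrable_mollify_integrand:
  fixes w :: "'a::euclidean_space \<Rightarrow> real"
  assumes "\<epsilon> > 0" "integrable lebesgue w"
  shows "integrable lebesgue (\<lambda>y. J_eps \<epsilon> (x - y) * w y)"
  by (rule bounded_continuous_of_bounded_support[OF continuous_on_J_eps bounded_support_J_eps[OF assms(1)]])
     (rule integrable_bounded_continuous_mult[OF continuous_on_J_eps _ assms(2)])

lemma mollify_diff:
  fixes v w :: "'a::euclidean_space \<Rightarrow> real"
  assumes "\<epsilon> > 0" "integrable lebesgue v" "integrable lebesgue w"
  shows "mollify \<epsilon> (\<lambda>x. v x - w x) x = mollify \<epsilon> v x - mollify \<epsilon> w x"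
  by (simp add: mollify_def right_diff_distrib integrable_mollify_integrand assms)

lemma mollify_eq_0:
  fixes w :: "'a::euclidean_space \<Rightarrow> real"
  assumes "\<epsilon> > 0" "\<And>y. w y \<noteq> 0 \<Longrightarrow> \<epsilon> \<le> dist x y"
  shows "mollify \<epsilon> w x = 0"
proof -
  have "J_eps \<epsilon> (x - y) * w y = 0" for y
    using assms J_eps_eq_0[of \<epsilon> "x - y"] by (cases "w y = 0") (auto simp: dist_norm)
  then show ?thesis
    unfolding mollify_def by (simp only: Bochner_Integration.integral_zero)
qed

text \<open>The kernel is a nonnegative weight of mass one on a ball of radius \<epsilon>, so
  mollification is a local average. Taking c to be a function value gives uniform convergence; c = 0
  gives a sup bound.\<close>

lemma mollify_dist_le:
  fixes w :: "'a::euclidean_space \<Rightarrow> real"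
  assumes "\<epsilon> > 0" "integrable lebesgue w" "\<And>y. dist x y < \<epsilon> \<Longrightarrow> \<bar>w y - c\<bar> \<le> e"
  shows "\<bar>mollify \<epsilon> w x - c\<bar> \<le> e"
proof -
  note int = integrable_mollify_integrand[OF assms(1,2), of x] integrable_J_eps[OF assms(1), of x]
  have "mollify \<epsilon> w x - c = (\<integral>y. J_eps \<epsilon> (x - y) * (w y - c) \<partial>lebesgue)"
    using int by (simp add: mollify_def right_diff_distrib integral_J_eps assms(1))
  also have "\<bar>\<dots>\<bar> \<le> (\<integral>y. J_eps \<epsilon> (x - y) * e \<partial>lebesgue)"
    unfolding real_norm_def[symmetric]
  proof (rule Bochner_Integration.integral_norm_bound_integral)
    show "integrable lebesgue (\<lambda>y. J_eps \<epsilon> (x - y) * (w y - c))"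
      using int by (simp add: right_diff_distrib)
    show "integrable lebesgue (\<lambda>y. J_eps \<epsilon> (x - y) * e)" using int by simp
    show "norm (J_eps \<epsilon> (x - y) * (w y - c)) \<le> J_eps \<epsilon> (x - y) * e" for y
      using J_eps_nonneg[OF assms(1), of "x - y"] J_eps_eq_0[OF assms(1), of "x - y"] assms(3)[of y]
      by (cases "dist x y < \<epsilon>") (auto simp: abs_mult dist_norm intro!: mult_left_mono)
  qed
  also have "\<dots> = e" by (simp add: integral_J_eps assms(1))
  finally show ?thesis .
qed

text \<open>The absolute value is moved inside the integral, the order of integration is exchanged,
  and by symmetry the kernel has mass one in the other variable too.\<close>

lemma nn_integral_mollify_le:
  fixes w :: "'a::euclidean_space \<Rightarrow> real"
  assumes "\<epsilon> > 0" "integrable lebesgue w"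
  shows "(\<integral>\<^sup>+x. ennreal \<bar>mollify \<epsilon> w x\<bar> \<partial>lebesgue) \<le> (\<integral>\<^sup>+x. ennreal \<bar>w x\<bar> \<partial>lebesgue)"
proof -
  \<comment> \<open>|w| is replaced by a Borel function equal to it almost everywhere, so that the
    integrand is jointly measurable for Fubini on \<open>lborel\<close>.\<close>
  have "(\<lambda>x. ennreal \<bar>w x\<bar>) \<in> borel_measurable lebesgue" using assms(2) by auto
  then obtain w' where [measurable]: "w' \<in> borel_measurable lborel"
    and w': "AE x in lborel. ennreal \<bar>w x\<bar> = w' x"
    using completion_ex_borel_measurable by blast
  have le: "ennreal \<bar>mollify \<epsilon> w x\<bar> \<le> (\<integral>\<^sup>+y. ennreal (J_eps \<epsilon> (x - y)) * w' y \<partial>lborel)" for x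
  proof -
    have "ennreal \<bar>mollify \<epsilon> w x\<bar> \<le> (\<integral>\<^sup>+y. ennreal (norm (J_eps \<epsilon> (x - y) * w y)) \<partial>lebesgue)"
      unfolding mollify_def real_norm_def[symmetric]
      by (rule integral_norm_bound_ennreal[OF integrable_mollify_integrand[OF assms]])
    also have "\<dots> = (\<integral>\<^sup>+y. ennreal (J_eps \<epsilon> (x - y)) * ennreal \<bar>w y\<bar> \<partial>lborel)"
      using assms(1)
      by (auto simp: nn_integral_completion abs_mult J_eps_nonneg ennreal_mult' intro!: nn_integral_cong)
    also have "\<dots> = (\<integral>\<^sup>+y. ennreal (J_eps \<epsilon> (x - y)) * w' y \<partial>lborel)"
      using w' by (intro nn_integral_cong_AE) auto
    finally show ?thesis .
  qed
  have "(\<integral>\<^sup>+x. ennreal \<bar>mollify \<epsilon> w x\<bar> \<partial>lebesgue) \<le>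
      (\<integral>\<^sup>+x. \<integral>\<^sup>+y. ennreal (J_eps \<epsilon> (x - y)) * w' y \<partial>lborel \<partial>lborel)"
    by (simp add: nn_integral_completion nn_integral_mono le)
  also have "\<dots> = (\<integral>\<^sup>+y. \<integral>\<^sup>+x. ennreal (J_eps \<epsilon> (x - y)) * w' y \<partial>lborel \<partial>lborel)"
    by (rule lborel_pair.Fubini'[symmetric]) measurable
  also have "\<dots> = (\<integral>\<^sup>+y. (\<integral>\<^sup>+x. ennreal (J_eps \<epsilon> (y - x)) \<partial>lborel) * w' y \<partial>lborel)"
    by (simp add: nn_integral_multc J_eps_minus_commute[of \<epsilon> _ "_::'a"])
  also have "\<dots> = (\<integral>\<^sup>+x. ennreal \<bar>w x\<bar> \<partial>lebesgue)"
    using w' assms(1)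
    by (auto simp: nn_integral_J_eps nn_integral_completion intro!: nn_integral_cong_AE)
  finally show ?thesis .
qed

section \<open>Convergence of mollifications in L1\<close>

lemma mollify_uniformly_close:
  fixes h :: "'a::euclidean_space \<Rightarrow> real"
  assumes h: "continuous_on UNIV h" "integrable lebesgue h" "bounded {x. h x \<noteq> 0}" and "e > 0"
  obtains d where "d > 0" "\<And>\<epsilon> x. 0 < \<epsilon> \<Longrightarrow> \<epsilon> < d \<Longrightarrow> \<bar>mollify \<epsilon> h x - h x\<bar> \<le> e"
proof -
  obtain R where R: "\<And>x. h x \<noteq> 0 \<Longrightarrow> norm x \<le> R"
    using h(3) by (auto simp: bounded_iff)
  \<comment> \<open>The margin 1 exceeds \<epsilon>: if one of two points at distance less than
    \<epsilon> leaves this ball, both lie outside radius R, where h vanishes.\<close>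
  have "uniformly_continuous_on (cball 0 (R + 1)) h"
    using h(1) by (intro compact_uniformly_continuous) (auto intro: continuous_on_subset)
  then obtain d where d: "d > 0"
    "\<And>x y. norm x \<le> R + 1 \<Longrightarrow> norm y \<le> R + 1 \<Longrightarrow> dist x y < d \<Longrightarrow> dist (h x) (h y) < e"
    using \<open>e > 0\<close> unfolding uniformly_continuous_on_def by (auto simp: dist_commute)
  show ?thesis
  proof (rule that[of "min d 1"])
    fix \<epsilon> :: real and x :: 'a assume \<epsilon>: "0 < \<epsilon>" "\<epsilon> < min d 1"
    show "\<bar>mollify \<epsilon> h x - h x\<bar> \<le> e"
    proof (rule mollify_dist_le[OF \<epsilon>(1) h(2)])
      fix y assume y: "dist x y < \<epsilon>"
      show "\<bar>h y - h x\<bar> \<le> e"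
      proof (cases "norm x \<le> R + 1 \<and> norm y \<le> R + 1")
        case True
        then show ?thesis using d(2)[of x y] y \<epsilon>(2) by (simp add: dist_real_def abs_minus_commute)
      next
        case False
        have "\<bar>norm x - norm y\<bar> < 1"
          using y \<epsilon>(2) norm_triangle_ineq3[of x y] by (simp add: dist_norm)
        with False R[of x] R[of y] have "h x = 0" "h y = 0" by fastforce+
        then show ?thesis using \<open>e > 0\<close> by simp
      qed
    qed
  qed (use d in auto)
qed

lemma integrable_bounded_support:
  fixes w :: "'a::euclidean_space \<Rightarrow> real"
  assumes "w \<in> borel_measurable lebesgue" "\<And>x. \<bar>w x\<bar> \<le> B" "bounded {x. w x \<noteq> 0}"
  shows "integrable lebesgue w"
proof -
  obtain R where R: "{x. w x \<noteq> 0} \<subseteq> cball 0 R"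
    using assms(3) by (auto simp: bounded_iff subset_eq)
  show ?thesis
  proof (rule Bochner_Integration.integrable_bound)
    show "integrable lebesgue (\<lambda>x. B * indicat_real (cball (0::'a) R) x)"
      by (intro integrable_mult_right lmeasurable_iff_integrable[THEN iffD1] lmeasurable_cball)
    show "AE x in lebesgue. norm (w x) \<le> norm (B * indicat_real (cball 0 R) x)"
    proof (intro always_eventually allI)
      fix x show "norm (w x) \<le> norm (B * indicat_real (cball 0 R) x)"
        using R assms(2)[of x] by (cases "x \<in> cball 0 R") auto
    qed
  qed (rule assms)
qed

text \<open>A measurable function is an almost everywhere limit of continuous ones. Clipping these
  to [-B, B] and cutting them off preserves the limit, since w obeys the same constraints, and
  supplies an integrable majorant.\<close>

lemma continuous_L1_approximation:
  fixes w :: "'a::euclidean_space \<Rightarrow> real"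
  assumes w: "w \<in> borel_measurable lebesgue" "\<And>x. \<bar>w x\<bar> \<le> B" "bounded {x. w x \<noteq> 0}" and "e > 0"
  obtains h where "continuous_on UNIV h" "bounded {x. h x \<noteq> 0}" "\<And>x. \<bar>h x\<bar> \<le> B"
    "(\<integral>\<^sup>+x. ennreal \<bar>w x - h x\<bar> \<partial>lebesgue) < ennreal e"
proof -
  have B: "B \<ge> 0" using w(2)[of undefined] by simp
  obtain R where R: "\<And>x. w x \<noteq> 0 \<Longrightarrow> norm x \<le> R"
    using w(3) by (auto simp: bounded_iff)
  have "w measurable_on UNIV"
    using lebesgue_measurable_imp_measurable_on_real[OF w(1), of UNIV] by simp
  then obtain N g where N: "negligible N" and g: "\<And>n::nat. continuous_on UNIV (g n)"
    and lim: "\<And>x. x \<notin> N \<Longrightarrow> (\<lambda>n. g n x) \<longlonglongrightarrow> w x"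
    unfolding measurable_on_def by auto
  \<comment> \<open>A continuous cutoff: 1 on the ball of radius R, which contains the support of w,
    and 0 outside radius R + 1.\<close>
  define c where "c x = max 0 (min 1 (R + 1 - norm x))" for x :: 'a
  define h where "h n x = c x * max (- B) (min B (g n x))" for n x
  have c: "0 \<le> c x" "c x \<le> 1" for x by (auto simp: c_def)
  have cont: "continuous_on UNIV (h n)" for n
    unfolding h_def c_def by (intro continuous_intros g)
  have supp: "h n x \<noteq> 0 \<Longrightarrow> norm x \<le> R + 1" for n x
    by (auto simp: h_def c_def split: if_splits)
  have bnd: "\<bar>h n x\<bar> \<le> B" for n x
  proof -
    have "\<bar>h n x\<bar> \<le> 1 * B"
      unfolding h_def abs_mult using c[of x] B by (intro mult_mono) auto
    then show ?thesis by simp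
  qed
  have "(\<lambda>n. \<integral>\<^sup>+x. ennreal \<bar>w x - h n x\<bar> \<partial>lebesgue) \<longlonglongrightarrow> (\<integral>\<^sup>+x. 0 \<partial>(lebesgue::'a measure))"
  proof (rule nn_integral_dominated_convergence)
    show "(\<lambda>x. ennreal \<bar>w x - h n x\<bar>) \<in> borel_measurable lebesgue" for n
      using continuous_on_UNIV_measurable_lebesgue[OF cont[of n]] w(1) by measurable
    show "(\<lambda>x. ennreal (2 * B) * indicator (cball (0::'a) (R + 1)) x) \<in> borel_measurable lebesgue"
      by (intro borel_measurable_times_ennreal borel_measurable_const borel_measurable_indicator) simp
    have "\<bar>w x - h n x\<bar> \<le> 2 * B" for n x
      using w(2)[of x] bnd[of n x] by linarith
    moreover have "w x = 0" "h n x = 0" if "norm x > R + 1" for n x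
      using that R[of x] supp[of n x] by fastforce+
    ultimately show "AE x in lebesgue.
        ennreal \<bar>w x - h n x\<bar> \<le> ennreal (2 * B) * indicator (cball 0 (R + 1)) x" for n
      by (intro always_eventually) (auto simp: indicator_def not_le intro!: ennreal_leI)
    show "(\<integral>\<^sup>+x. ennreal (2 * B) * indicator (cball (0::'a) (R + 1)) x \<partial>lebesgue) < \<infinity>"
      using emeasure_lborel_cball_finite[of "0::'a" "R + 1"]
      by (simp add: nn_integral_cmult_indicator ennreal_mult_less_top)
    have "N \<in> null_sets lebesgue" using N by (simp add: negligible_iff_null_sets)
    then show "AE x in lebesgue. (\<lambda>n. ennreal \<bar>w x - h n x\<bar>) \<longlonglongrightarrow> 0"
    proof (rule AE_I')
      show "{x \<in> space lebesgue. \<not> (\<lambda>n. ennreal \<bar>w x - h n x\<bar>) \<longlonglongrightarrow> 0} \<subseteq> N"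
      proof (rule subsetI, rule ccontr)
        fix x assume x: "x \<in> {x \<in> space lebesgue. \<not> (\<lambda>n. ennreal \<bar>w x - h n x\<bar>) \<longlonglongrightarrow> 0}" "x \<notin> N"
        have "(\<lambda>n. h n x) \<longlonglongrightarrow> c x * max (- B) (min B (w x))"
          unfolding h_def by (intro tendsto_intros lim x)
        also have "c x * max (- B) (min B (w x)) = w x"
          using w(2)[of x] R[of x] by (cases "w x = 0") (auto simp: c_def B)
        finally have "(\<lambda>n. \<bar>w x - h n x\<bar>) \<longlonglongrightarrow> \<bar>w x - w x\<bar>"
          by (intro tendsto_intros)
        then have "(\<lambda>n. ennreal \<bar>w x - h n x\<bar>) \<longlonglongrightarrow> ennreal 0"
          by (intro tendsto_ennrealI) simp
        with x show False by simp
      qed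
    qed
  qed simp
  then have "\<forall>\<^sub>F n in sequentially. (\<integral>\<^sup>+x. ennreal \<bar>w x - h n x\<bar> \<partial>lebesgue) < ennreal e"
    using \<open>e > 0\<close> by (intro order_tendstoD(2)[of _ 0]) auto
  then obtain n where "(\<integral>\<^sup>+x. ennreal \<bar>w x - h n x\<bar> \<partial>lebesgue) < ennreal e"
    using eventually_happens by force
  moreover have "bounded {x. h n x \<noteq> 0}"
    using supp by (auto simp: bounded_iff)
  ultimately show ?thesis using that cont bnd by blast
qed

lemma tendsto_ennreal_0I:
  fixes f :: "'b \<Rightarrow> ennreal"
  assumes "\<And>e. e > 0 \<Longrightarrow> \<forall>\<^sub>F x in F. f x \<le> ennreal e"
  shows "(f \<longlongrightarrow> 0) F"
proof (rule order_tendstoI)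
  fix a :: ennreal assume "0 < a"
  then obtain r where r: "0 < r" "r < a" using dense by blast
  then obtain e where e: "r = ennreal e" "e \<ge> 0"
    by (metis ennreal_cases less_top order_less_trans top.not_eq_extremum)
  with r have "e > 0" by (cases "e = 0") auto
  from assms[OF this] show "\<forall>\<^sub>F x in F. f x < a"
    by eventually_elim (use r e in auto)
qed auto

text \<open>An e/3 argument: the mollification of w - h is controlled by the L1 contraction, that of
  h by uniform closeness on a fixed ball, and w - h by the choice of h.\<close>

lemma mollify_tendsto_L1:
  fixes w :: "'a::euclidean_space \<Rightarrow> real"
  assumes w: "w \<in> borel_measurable lebesgue" "\<And>x. \<bar>w x\<bar> \<le> B" "bounded {x. w x \<noteq> 0}"
  shows "((\<lambda>\<epsilon>. \<integral>\<^sup>+x. ennreal \<bar>mollify \<epsilon> w x - w x\<bar> \<partial>lebesgue) \<longlongrightarrow> 0) (at_right 0)"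
proof (rule tendsto_ennreal_0I)
  fix e :: real assume "e > 0"
  have intw: "integrable lebesgue w" by (rule integrable_bounded_support[OF w])
  obtain h where h: "continuous_on UNIV h" "bounded {x. h x \<noteq> 0}" "\<And>x. \<bar>h x\<bar> \<le> B"
    and wh: "(\<integral>\<^sup>+x. ennreal \<bar>w x - h x\<bar> \<partial>lebesgue) < ennreal (e / 3)"
    using continuous_L1_approximation[OF w, of "e / 3"] \<open>e > 0\<close> by auto
  have inth: "integrable lebesgue h"
    by (rule integrable_bounded_support[OF continuous_on_UNIV_measurable_lebesgue h(3,2)]) (rule h)
  obtain R where R: "\<And>x. h x \<noteq> 0 \<Longrightarrow> norm x \<le> R"
    using h(2) by (auto simp: bounded_iff)
  define V where "V = measure lborel (cball (0::'a) (R + 1))"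
  \<comment> \<open>A uniform error \<eta> on a ball of volume V costs at most \<eta> V in L1; the
    summand 1 guards against V = 0.\<close>
  define \<eta> where "\<eta> = e / (3 * (V + 1))"
  have "V \<ge> 0" by (simp add: V_def)
  have "\<eta> > 0" using \<open>e > 0\<close> \<open>V \<ge> 0\<close> by (simp add: \<eta>_def)
  have \<eta>V: "\<eta> * V \<le> e / 3" using \<open>e > 0\<close> \<open>V \<ge> 0\<close> by (simp add: \<eta>_def field_simps)
  obtain d where d: "d > 0" "\<And>\<epsilon> x. 0 < \<epsilon> \<Longrightarrow> \<epsilon> < d \<Longrightarrow> \<bar>mollify \<epsilon> h x - h x\<bar> \<le> \<eta>"
    using mollify_uniformly_close[OF h(1) inth h(2) \<open>\<eta> > 0\<close>] by blast
  have "\<forall>\<^sub>F \<epsilon> in at_right 0. 0 < \<epsilon> \<and> \<epsilon> < min d (1::real)"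
    using d(1) by (auto simp: eventually_at_right_field intro!: exI[of _ "min d 1"])
  then show "\<forall>\<^sub>F \<epsilon> in at_right 0.
      (\<integral>\<^sup>+x. ennreal \<bar>mollify \<epsilon> w x - w x\<bar> \<partial>lebesgue) \<le> ennreal e"
  proof eventually_elim
    case (elim \<epsilon>)
    then have \<epsilon>: "0 < \<epsilon>" "\<epsilon> < d" "\<epsilon> < 1" by auto
    let ?wh = "\<lambda>x. w x - h x"
    have intwh: "integrable lebesgue ?wh" using intw inth by simp
    have [measurable]: "mollify \<epsilon> ?wh \<in> borel_measurable lebesgue"
      by (intro continuous_on_UNIV_measurable_lebesgue continuous_on_mollify \<epsilon> intwh)
    have [measurable]: "cball (0::'a) (R + 1) \<in> sets lebesgue" by simp
    have [measurable]: "?wh \<in> borel_measurable lebesgue"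
      using intwh by auto
    have "ennreal \<bar>mollify \<epsilon> w x - w x\<bar> \<le> ennreal \<bar>mollify \<epsilon> ?wh x\<bar> +
        (ennreal \<eta> * indicator (cball 0 (R + 1)) x + ennreal \<bar>?wh x\<bar>)" for x
    proof -
      \<comment> \<open>As \<epsilon> < 1, both h and its mollification vanish outside radius R + 1,
        so the uniform error may be multiplied by the indicator of that ball.\<close>
      have close: "\<bar>mollify \<epsilon> h x - h x\<bar> \<le> \<eta> * indicator (cball 0 (R + 1)) x"
      proof (cases "norm x \<le> R + 1")
        case False
        have "h x = 0" using R[of x] False by fastforce
        moreover have "mollify \<epsilon> h x = 0"
        proof (rule mollify_eq_0[OF \<epsilon>(1)])
          fix y assume "h y \<noteq> 0"
          then show "\<epsilon> \<le> dist x y"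
            using R[of y] False \<epsilon>(3) norm_triangle_ineq2[of x y] by (simp add: dist_norm)
        qed
        ultimately show ?thesis using \<open>\<eta> > 0\<close> by simp
      qed (use d(2)[OF \<epsilon>(1,2)] in simp)
      have "\<bar>mollify \<epsilon> w x - w x\<bar> \<le>
          \<bar>mollify \<epsilon> ?wh x\<bar> + (\<eta> * indicator (cball 0 (R + 1)) x + \<bar>?wh x\<bar>)"
        using close mollify_diff[OF \<epsilon>(1) intw inth, of x] by linarith
      then have "ennreal \<bar>mollify \<epsilon> w x - w x\<bar> \<le>
          ennreal (\<bar>mollify \<epsilon> ?wh x\<bar> + (\<eta> * indicator (cball 0 (R + 1)) x + \<bar>?wh x\<bar>))"
        by (rule ennreal_leI)
      then show ?thesis
        using \<open>\<eta> > 0\<close> by (simp add: ennreal_mult' ennreal_indicator)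
    qed
    then have "(\<integral>\<^sup>+x. ennreal \<bar>mollify \<epsilon> w x - w x\<bar> \<partial>lebesgue) \<le>
        (\<integral>\<^sup>+x. ennreal \<bar>mollify \<epsilon> ?wh x\<bar> +
          (ennreal \<eta> * indicator (cball 0 (R + 1)) x + ennreal \<bar>?wh x\<bar>) \<partial>lebesgue)"
      by (rule nn_integral_mono)
    also have "\<dots> = (\<integral>\<^sup>+x. ennreal \<bar>mollify \<epsilon> ?wh x\<bar> \<partial>lebesgue) +
        (ennreal \<eta> * emeasure lborel (cball (0::'a) (R + 1)) + (\<integral>\<^sup>+x. ennreal \<bar>?wh x\<bar> \<partial>lebesgue))"
      by (simp add: nn_integral_add nn_integral_cmult_indicator)
    also have "\<dots> \<le> ennreal (e / 3) + (ennreal (e / 3) + ennreal (e / 3))"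
    proof (intro add_mono)
      show "(\<integral>\<^sup>+x. ennreal \<bar>mollify \<epsilon> ?wh x\<bar> \<partial>lebesgue) \<le> ennreal (e / 3)"
        using nn_integral_mollify_le[OF \<epsilon>(1) intwh] wh by simp
      have "emeasure lborel (cball (0::'a) (R + 1)) = ennreal V"
        using emeasure_lborel_cball_finite[of "0::'a" "R + 1"]
        by (simp add: V_def emeasure_eq_ennreal_measure)
      then show "ennreal \<eta> * emeasure lborel (cball (0::'a) (R + 1)) \<le> ennreal (e / 3)"
        using \<eta>V \<open>\<eta> > 0\<close> \<open>V \<ge> 0\<close> by (simp add: ennreal_mult[symmetric] ennreal_leI)
    qed (use wh in simp)
    also have "\<dots> = ennreal e"
      using \<open>e > 0\<close> by (simp flip: ennreal_plus)
    finally show ?case .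
  qed
qed

section \<open>Integrals against an integrable weight\<close>

lemma tendsto_weighted_nn_integral:
  fixes F :: "'a \<Rightarrow> ennreal" and w :: "'b \<Rightarrow> 'a \<Rightarrow> real"
  assumes F [measurable]: "F \<in> borel_measurable M" and fin: "(\<integral>\<^sup>+x. F x \<partial>M) < \<infinity>"
    and meas: "\<forall>\<^sub>F i in A. w i \<in> borel_measurable M"
    and bound: "\<forall>\<^sub>F i in A. \<forall>x\<in>space M. \<bar>w i x\<bar> \<le> C"
    and lim: "((\<lambda>i. \<integral>\<^sup>+x. ennreal \<bar>w i x\<bar> \<partial>M) \<longlongrightarrow> 0) A"
  shows "((\<lambda>i. \<integral>\<^sup>+x. ennreal \<bar>w i x\<bar> * F x \<partial>M) \<longlongrightarrow> 0) A"
proof (rule tendsto_ennreal_0I)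
  fix e :: real assume "e > 0"
  \<comment> \<open>Subtraction in \<open>ennreal\<close> truncates at 0, so this integrates the
    excess of F above height n. The excess is eventually 0 wherever F is finite, and is dominated by
    F.\<close>
  have "(\<lambda>n. \<integral>\<^sup>+x. F x - of_nat n \<partial>M) \<longlonglongrightarrow> (\<integral>\<^sup>+x. 0 \<partial>M)"
  proof (rule nn_integral_dominated_convergence[OF _ _ F _ fin])
    have "AE x in M. F x \<noteq> \<infinity>"
      using fin by (intro nn_integral_PInf_AE) auto
    then show "AE x in M. (\<lambda>n. F x - of_nat n) \<longlonglongrightarrow> 0"
    proof eventually_elim
      case (elim x)
      then obtain n where n: "F x < of_nat n" using ennreal_Ex_less_of_nat by (auto simp: less_top)
      have "F x - of_nat m = 0" if "m \<ge> n" for m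
      proof -
        have "F x \<le> of_nat m"
          using n of_nat_mono[OF that, where 'a=ennreal] by (meson less_imp_le order_trans)
        then show ?thesis by (simp add: diff_eq_0_iff_ennreal top.not_eq_extremum[symmetric] elim[simplified])
      qed
      then show ?case
        by (intro tendsto_eventually eventually_sequentiallyI[of n])
    qed
  qed (auto intro: diff_le_self_ennreal)
  then have "(\<lambda>n. ennreal C * (\<integral>\<^sup>+x. F x - of_nat n \<partial>M)) \<longlonglongrightarrow> ennreal C * 0"
    by (intro ennreal_tendsto_cmult) auto
  then have "\<forall>\<^sub>F n in sequentially. ennreal C * (\<integral>\<^sup>+x. F x - of_nat n \<partial>M) < ennreal (e / 2)"
    using \<open>e > 0\<close> by (intro order_tendstoD(2)) auto
  then obtain n where n: "ennreal C * (\<integral>\<^sup>+x. F x - of_nat n \<partial>M) < ennreal (e / 2)"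
    using eventually_happens by force
  have "((\<lambda>i. of_nat n * (\<integral>\<^sup>+x. ennreal \<bar>w i x\<bar> \<partial>M)) \<longlongrightarrow> of_nat n * 0) A"
    by (intro ennreal_tendsto_cmult lim) (simp add: of_nat_less_top)
  then have "\<forall>\<^sub>F i in A. of_nat n * (\<integral>\<^sup>+x. ennreal \<bar>w i x\<bar> \<partial>M) < ennreal (e / 2)"
    using \<open>e > 0\<close> by (intro order_tendstoD(2)) auto
  with meas bound show "\<forall>\<^sub>F i in A. (\<integral>\<^sup>+x. ennreal \<bar>w i x\<bar> * F x \<partial>M) \<le> ennreal e"
  proof eventually_elim
    case (elim i)
    note [measurable] = elim(1)
    \<comment> \<open>With n now fixed, the part of F below n is charged to the L1 norm of
      \<open>w i\<close>, and the excess to the uniform bound C.\<close>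
    have "ennreal \<bar>w i x\<bar> * F x \<le> of_nat n * ennreal \<bar>w i x\<bar> + ennreal C * (F x - of_nat n)"
      if "x \<in> space M" for x
    proof -
      have "F x \<le> of_nat n + (F x - of_nat n)"
        by (metis add.commute ennreal_minus_le_iff order_refl)
      then have "ennreal \<bar>w i x\<bar> * F x \<le> ennreal \<bar>w i x\<bar> * (of_nat n + (F x - of_nat n))"
        by (rule mult_left_mono) simp
      also have "\<dots> \<le> of_nat n * ennreal \<bar>w i x\<bar> + ennreal C * (F x - of_nat n)"
        unfolding distrib_left using elim(2) that
        by (intro add_mono mult_right_mono) (auto simp: mult.commute ennreal_leI)
      finally show ?thesis .
    qed
    then have "(\<integral>\<^sup>+x. ennreal \<bar>w i x\<bar> * F x \<partial>M) \<le>
        (\<integral>\<^sup>+x. of_nat n * ennreal \<bar>w i x\<bar> + ennreal C * (F x - of_nat n) \<partial>M)"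
      by (rule nn_integral_mono)
    also have "\<dots> = of_nat n * (\<integral>\<^sup>+x. ennreal \<bar>w i x\<bar> \<partial>M) + ennreal C * (\<integral>\<^sup>+x. F x - of_nat n \<partial>M)"
      by (simp add: nn_integral_add nn_integral_cmult)
    also have "\<dots> \<le> ennreal (e / 2) + ennreal (e / 2)"
      using elim(3) n by (intro add_mono) auto
    also have "\<dots> = ennreal e"
      using \<open>e > 0\<close> by (simp flip: ennreal_plus)
    finally show ?case .
  qed
qed

section \<open>From weighted integrals to the Luxemburg norm\<close>

lemma phi_function_scale_le:
  assumes "phi_function \<Omega> M" "x \<in> \<Omega>" "0 \<le> a" "a \<le> 1" "0 \<le> t"
  shows "M x (a * t) \<le> ennreal a * M x t"
proof -
  \<comment> \<open>Convexity on the segment from 0 to t.\<close>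
  have "M x (a * t + (1 - a) * 0) \<le> ennreal a * M x t + ennreal (1 - a) * M x 0"
    using assms unfolding phi_function_def
    by (metis add_diff_cancel_left' diff_add_cancel diff_ge_0_iff_ge add.commute order_refl)
  moreover have "M x 0 = 0" using assms unfolding phi_function_def by blast
  ultimately show ?thesis by simp
qed

lemma support_mollify_thickening:
  fixes u :: "'a::euclidean_space \<Rightarrow> real"
  assumes "0 < \<epsilon>" "\<epsilon> \<le> d" "compact (closure {x. u x \<noteq> 0})"
  defines "K \<equiv> \<Union>x\<in>closure {x. u x \<noteq> 0}. cball x d"
  shows "compact K" and "closure {x. mollify \<epsilon> u x \<noteq> 0} \<subseteq> K"
    and "{x. u x \<noteq> 0} \<subseteq> K"
proof -
  let ?S = "closure {x. u x \<noteq> 0}"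
  \<comment> \<open>K is a Minkowski sum of two compact sets, and it is the same for every
    \<epsilon> up to d.\<close>
  have "K = {x + y |x y. x \<in> ?S \<and> y \<in> cball 0 d}"
    by (force simp: K_def dist_norm norm_minus_commute)
  then show K: "compact K"
    using compact_sums[OF assms(3) compact_cball[of 0 d]] by simp
  have "x \<in> K" if "mollify \<epsilon> u x \<noteq> 0" for x
  proof -
    obtain y where "u y \<noteq> 0" "dist x y < \<epsilon>"
      using mollify_eq_0[OF assms(1), of u x] \<open>mollify \<epsilon> u x \<noteq> 0\<close> by force
    then show ?thesis
      using assms(2) closure_subset[of "{x. u x \<noteq> 0}"] by (auto simp: K_def dist_commute intro!: bexI[of _ y])
  qed
  then show "closure {x. mollify \<epsilon> u x \<noteq> 0} \<subseteq> K"
    using K by (intro closure_minimal compact_imp_closed) auto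
  show "{x. u x \<noteq> 0} \<subseteq> K"
    using assms(1,2) closure_subset[of "{x. u x \<noteq> 0}"] by (force simp: K_def)
qed

text \<open>The middle conjunct ensures that the infimum in \<open>luxemburg_norm\<close> is taken
  over a nonempty set for small \<epsilon>, so the limit concerns genuine norms.\<close>

theorem lemma3p2:
  fixes \<Omega> :: "'a::euclidean_space set"
    and M :: "'a \<Rightarrow> real \<Rightarrow> ennreal"
    and u :: "'a \<Rightarrow> real"
  assumes "open \<Omega>"
    and "Phi_function \<Omega> M"
    and "locally_integrable \<Omega> M"
    and "u \<in> bounded_compact_support \<Omega>"
  shows "(\<forall>\<^sub>F \<epsilon> in at_right 0. mollify \<epsilon> u \<in> test_functions \<Omega>) \<and>
    (\<forall>\<^sub>F \<epsilon> in at_right 0. (\<lambda>x. mollify \<epsilon> u x - u x) \<in> musielak_orlicz_space \<Omega> M) \<and>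
    ((\<lambda>\<epsilon>. luxemburg_norm \<Omega> M (\<lambda>x. mollify \<epsilon> u x - u x)) \<longlongrightarrow> 0) (at_right 0)"
proof (intro conjI)
  let ?S = "closure {x. u x \<noteq> 0}"
  have phi: "phi_function \<Omega> M" using assms(2) by (simp add: Phi_function_def)
  have [measurable]: "\<Omega> \<in> sets lebesgue" using assms(1) by simp
  have u: "u \<in> borel_measurable lebesgue" and S: "compact ?S" "?S \<subseteq> \<Omega>"
    using assms(4) by (auto simp: bounded_compact_support_def compactly_supported_in_def)
  have "bounded (range u)" using assms(4) by (simp add: bounded_compact_support_def)
  \<comment> \<open>The bound is taken strictly positive so that 2B can serve as a divisor.\<close>
  then obtain B where B: "B > 0" "\<And>x. \<bar>u x\<bar> \<le> B"
    by (auto simp: bounded_pos)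
  have supp: "bounded {x. u x \<noteq> 0}"
    using S(1) closure_subset compact_imp_bounded bounded_subset by metis
  have intu: "integrable lebesgue u" by (rule integrable_bounded_support[OF u B(2) supp])
  obtain d where d: "d > 0" "(\<Union>x\<in>?S. cball x d) \<subseteq> \<Omega>"
    using compact_subset_open_imp_cball_epsilon_subset[OF S(1) assms(1) S(2)] by blast
  define K where "K = (\<Union>x\<in>?S. cball x d)"
  \<comment> \<open>Since K does not depend on the mollification radius, compactness is obtained
    from the instance with radius d.\<close>
  have K: "compact K" "K \<subseteq> \<Omega>"
    using support_mollify_thickening(1)[of d d u] d S by (simp_all add: K_def)
  have K_meas [measurable]: "K \<in> sets lebesgue" using K(1) by (simp add: lmeasurable_compact fmeasurableD)
  have small: "\<forall>\<^sub>F \<epsilon> in at_right 0. 0 < \<epsilon> \<and> \<epsilon> \<le> d"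
    using d(1) by (auto simp: eventually_at_right_field intro!: exI[of _ d])
  show "\<forall>\<^sub>F \<epsilon> in at_right 0. mollify \<epsilon> u \<in> test_functions \<Omega>"
    using small
  proof eventually_elim
    case (elim \<epsilon>)
    have "closure {x. mollify \<epsilon> u x \<noteq> 0} \<subseteq> K"
      using support_mollify_thickening(2)[of \<epsilon> d u] elim S by (simp add: K_def)
    then show ?case
      using Ck_mollify[OF _ intu] elim K compact_Int_closed[of K "closure {x. mollify \<epsilon> u x \<noteq> 0}"]
      by (auto simp: test_functions_def compactly_supported_in_def Int_absorb1)
  qed
  define w where "w \<epsilon> x = mollify \<epsilon> u x - u x" for \<epsilon> x
  have meas: "w \<epsilon> \<in> borel_measurable lebesgue" if "\<epsilon> > 0" for \<epsilon>
    using continuous_on_UNIV_measurable_lebesgue[OF continuous_on_mollify[OF that intu]] u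
    unfolding w_def[abs_def] by measurable
  have bound: "\<bar>w \<epsilon> x\<bar> \<le> 2 * B" if "\<epsilon> > 0" for \<epsilon> x
    using mollify_dist_le[OF that intu, of x 0 B] B(2) B(2)[of x] unfolding w_def by fastforce
  have supp_w: "w \<epsilon> x = 0" if "x \<notin> K" "0 < \<epsilon>" "\<epsilon> \<le> d" for \<epsilon> x
  proof -
    have "mollify \<epsilon> u x = 0" "u x = 0"
      using that support_mollify_thickening(2,3)[of \<epsilon> d u] S closure_subset[of "{x. mollify \<epsilon> u x \<noteq> 0}"]
      unfolding K_def by blast+
    then show ?thesis by (simp add: w_def)
  qed
  have lim: "((\<lambda>\<epsilon>. modular \<Omega> M (\<lambda>x. w \<epsilon> x / l)) \<longlongrightarrow> 0) (at_right 0)" if "l > 0" for l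
  proof (rule tendsto_sandwich[OF _ _ tendsto_const])
    \<comment> \<open>As |w| is at most 2B, |w|/l is the fraction |w|/(2B) of t, and this fraction
      is at most 1, as \<open>phi_function_scale_le\<close> requires.\<close>
    define t where "t = 2 * B / l"
    have t: "t > 0" using B \<open>l > 0\<close> by (simp add: t_def)
    \<comment> \<open>The indicator of \<open>\<Omega>\<close> is kept because M(.,t) is known to be
      measurable only on \<open>\<Omega>\<close>; the one of K makes the weight integrable.\<close>
    define F where "F x = M x t * indicator \<Omega> x * indicator K x" for x
    have "(\<lambda>x. M x t) \<in> borel_measurable (lebesgue_on \<Omega>)"
      using phi t by (auto simp: phi_function_def)
    then have [measurable]: "F \<in> borel_measurable lebesgue"
      unfolding F_def by (subst (asm) borel_measurable_restrict_space_iff_ennreal) auto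
    have "(\<integral>\<^sup>+x. F x \<partial>lebesgue) = (\<integral>\<^sup>+x. M x t \<partial>lebesgue_on K)"
      using K(2) by (auto simp: nn_integral_restrict_space F_def indicator_def intro!: nn_integral_cong)
    also have "\<dots> < \<infinity>"
      using assms(3) K t by (simp add: locally_integrable_def)
    finally have F_fin: "(\<integral>\<^sup>+x. F x \<partial>lebesgue) < \<infinity>" .
    have "((\<lambda>\<epsilon>. \<integral>\<^sup>+x. ennreal \<bar>w \<epsilon> x\<bar> * F x \<partial>lebesgue) \<longlongrightarrow> 0) (at_right 0)"
    proof (rule tendsto_weighted_nn_integral[where C = "2 * B", OF _ F_fin])
      show "\<forall>\<^sub>F \<epsilon> in at_right 0. w \<epsilon> \<in> borel_measurable lebesgue"
        using small by eventually_elim (use meas in auto)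
      show "\<forall>\<^sub>F \<epsilon> in at_right 0. \<forall>x\<in>space lebesgue. \<bar>w \<epsilon> x\<bar> \<le> 2 * B"
        using small by eventually_elim (use bound in auto)
      show "((\<lambda>\<epsilon>. \<integral>\<^sup>+x. ennreal \<bar>w \<epsilon> x\<bar> \<partial>lebesgue) \<longlongrightarrow> 0) (at_right 0)"
        unfolding w_def by (rule mollify_tendsto_L1[OF u B(2) supp])
    qed simp
    then have "((\<lambda>\<epsilon>. ennreal (1 / (2 * B)) * (\<integral>\<^sup>+x. ennreal \<bar>w \<epsilon> x\<bar> * F x \<partial>lebesgue)) \<longlongrightarrow>
        ennreal (1 / (2 * B)) * 0) (at_right 0)"
      by (intro ennreal_tendsto_cmult) auto
    then show "((\<lambda>\<epsilon>. ennreal (1 / (2 * B)) * (\<integral>\<^sup>+x. ennreal \<bar>w \<epsilon> x\<bar> * F x \<partial>lebesgue)) \<longlongrightarrow> 0) (at_right 0)"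
      by simp
    show "\<forall>\<^sub>F \<epsilon> in at_right 0. modular \<Omega> M (\<lambda>x. w \<epsilon> x / l) \<le>
        ennreal (1 / (2 * B)) * (\<integral>\<^sup>+x. ennreal \<bar>w \<epsilon> x\<bar> * F x \<partial>lebesgue)"
      using small
    proof eventually_elim
      case (elim \<epsilon>)
      then have [measurable]: "w \<epsilon> \<in> borel_measurable lebesgue" using meas by blast
      \<comment> \<open>On K this is the convexity estimate; off K the difference is 0, and M(x,0) =
        0 on \<open>\<Omega>\<close>.\<close>
      have "M x \<bar>w \<epsilon> x / l\<bar> * indicator \<Omega> x \<le> ennreal (1 / (2 * B)) * (ennreal \<bar>w \<epsilon> x\<bar> * F x)" for x
      proof (cases "x \<in> K")
        case True
        have "M x \<bar>w \<epsilon> x / l\<bar> = M x (\<bar>w \<epsilon> x\<bar> / (2 * B) * t)"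
          using B \<open>l > 0\<close> by (simp add: t_def)
        also have "\<dots> \<le> ennreal (\<bar>w \<epsilon> x\<bar> / (2 * B)) * M x t"
          using True K B t bound[of \<epsilon> x] elim by (intro phi_function_scale_le[OF phi]) auto
        also have "ennreal (\<bar>w \<epsilon> x\<bar> / (2 * B)) = ennreal (1 / (2 * B)) * ennreal \<bar>w \<epsilon> x\<bar>"
          using B by (simp flip: ennreal_mult')
        finally show ?thesis using True K by (auto simp: F_def mult.assoc indicator_def)
      next
        case False
        then have "w \<epsilon> x = 0" using supp_w elim by blast
        moreover have "x \<in> \<Omega> \<Longrightarrow> M x 0 = 0" using phi by (simp add: phi_function_def)
        ultimately show ?thesis by (cases "x \<in> \<Omega>") simp_all
      qed
      then have "modular \<Omega> M (\<lambda>x. w \<epsilon> x / l) \<le>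
          (\<integral>\<^sup>+x. ennreal (1 / (2 * B)) * (ennreal \<bar>w \<epsilon> x\<bar> * F x) \<partial>lebesgue)"
        unfolding modular_def by (subst nn_integral_restrict_space) (auto intro!: nn_integral_mono)
      then show ?case by (simp add: nn_integral_cmult)
    qed
  qed auto
  \<comment> \<open>The modular tends to 0 for every scale l: l = 1 yields membership in the space,
    and l = e/2 the norm estimate.\<close>
  then have le1: "\<forall>\<^sub>F \<epsilon> in at_right 0. modular \<Omega> M (\<lambda>x. w \<epsilon> x / l) \<le> 1" if "l > 0" for l
    using order_tendstoD(2)[OF lim[OF that], of 1] by (auto elim: eventually_mono)
  show "\<forall>\<^sub>F \<epsilon> in at_right 0. (\<lambda>x. mollify \<epsilon> u x - u x) \<in> musielak_orlicz_space \<Omega> M"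
    using small le1[of 1, OF zero_less_one] unfolding w_def[symmetric]
  proof eventually_elim
    case (elim \<epsilon>)
    have "w \<epsilon> \<in> borel_measurable (lebesgue_on \<Omega>)"
      using meas[of \<epsilon>] elim by (auto intro: measurable_restrict_space1)
    moreover have "modular \<Omega> M (\<lambda>x. w \<epsilon> x / 1) < \<infinity>"
      using elim(2) by (rule le_less_trans) simp
    ultimately show ?case
      unfolding musielak_orlicz_space_def using zero_less_one by blast
  qed
  show "((\<lambda>\<epsilon>. luxemburg_norm \<Omega> M (\<lambda>x. mollify \<epsilon> u x - u x)) \<longlongrightarrow> 0) (at_right 0)"
    unfolding w_def[symmetric]
  proof (rule tendstoI)
    fix e :: real assume "e > 0"
    show "\<forall>\<^sub>F \<epsilon> in at_right 0. dist (luxemburg_norm \<Omega> M (w \<epsilon>)) 0 < e"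
      using le1[of "e / 2", OF half_gt_zero[OF \<open>e > 0\<close>]]
    proof eventually_elim
      case (elim \<epsilon>)
      let ?L = "{l. l > 0 \<and> modular \<Omega> M (\<lambda>x. w \<epsilon> x / l) \<le> 1}"
      \<comment> \<open>The witness e/2 leaves room for the strict inequality; it also makes the set
        nonempty, which the lower bound 0 for the infimum needs.\<close>
      have mem: "e / 2 \<in> ?L" using elim \<open>e > 0\<close> by simp
      then have "Inf ?L \<le> e / 2"
        by (intro cInf_lower) (auto intro!: bdd_belowI[of _ 0])
      moreover have "Inf ?L \<ge> 0"
      proof (rule cInf_greatest)
        show "?L \<noteq> {}" using mem by blast
      qed simp
      ultimately show ?case using \<open>e > 0\<close> by (simp add: luxemburg_norm_def)
    qed
  qed
qed

end
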